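(* Let $x\in(0,1)$, $k\in\mathbb{N}_0$, and $\lambda\in\mathbb{C}$ with $(2\lambda+2k+1)_{2k+1}\ne0$. Then $$\sum_{n=0}^{2k+1}\frac{(\lambda)_n\,\mathcal{G}_n\left(-2k-\lambda-\frac12,-2k-\lambda-\frac12,\sqrt{\frac{1-x}{1+x}}\right)}{(2\lambda+2k+1)_n\,(-2)^{-n}(1-x^2)^{-\frac n2}x^n}\,C_{2k-n+1}^{\lambda+n}\!\left(\frac1x\right)=0,$$ $$\sum_{n=0}^{2k+1}\frac{(\lambda)_n\,\widehat{\mathcal{G}}_n\left(-2k-\lambda-\frac12,-2k-\lambda-\frac12,\sqrt{\frac{1-x}{1+x}}\right)}{(2\lambda+2k+1)_n\,(-2)^{-n}(1-x^2)^{-\frac n2}}\,C_{2k-n+1}^{\lambda+n}(x)=0.$$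
   Context: $\mathbb{N}_0=\{0,1,2,\dots\}$; $(a)_n=a(a+1)\cdots(a+n-1)$, $(a)_0=1$. $C_k^{\lambda}(x)=\sum_{j=0}^{[k/2]}\frac{(-1)^j(\lambda)_{k-j}}{j!\,(k-2j)!}(2x)^{k-2j}$ is the Gegenbauer polynomial, for any $\lambda\in\mathbb{C}$. The functions $\mathcal{G}_n(\tau,\rho,w)$ and $\widehat{\mathcal{G}}_n(\tau,\rho,\eta)$ are the Maclaurin coefficients $$(1-wz)^{\tau}\left(1+\frac zw\right)^{-\tau}(1+z^2)^{-\rho}=\sum_{n=0}^\infty\mathcal{G}_n(\tau,\rho,w)z^n,$$ $$(1+\eta\zeta)^{\tau}\left(1+\frac\zeta\eta\right)^{-\tau}(1-\zeta^2)^{-\rho}=\sum_{n=0}^\infty\widehat{\mathcal{G}}_n(\tau,\rho,\eta)\zeta^n,$$ for small $|z|,|\zeta|$, each factor being $1$ at $0$. *)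

theory Defs
  imports "HOL-Complex_Analysis.Complex_Analysis"
begin

definition gegenbauer :: "nat \<Rightarrow> complex \<Rightarrow> complex \<Rightarrow> complex" where
  "gegenbauer k lam x =
     (\<Sum>j=0..k div 2. (-1) ^ j * pochhammer lam (k - j) / (fact j * fact (k - 2 * j))
        * (2 * x) ^ (k - 2 * j))"

text \<open>
  Maclaurin coefficients of the two generating functions. Near the origin the bases of the
  powers are close to \<open>1\<close>, so the principal branch used by \<^const>\<open>powr\<close> is holomorphic there,
  and it is the branch that takes the value \<open>1\<close> at the origin. The parameters \<open>w\<close> and
  \<open>\<eta>\<close> are meant to be nonzero.
\<close>

definition calG :: "nat \<Rightarrow> complex \<Rightarrow> complex \<Rightarrow> complex \<Rightarrow> complex" where
  "calG n \<tau> \<rho> w =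
     fps_nth (fps_expansion
       (\<lambda>z. (1 - w * z) powr \<tau> * (1 + z / w) powr (- \<tau>) * (1 + z\<^sup>2) powr (- \<rho>)) 0) n"

definition calG_hat :: "nat \<Rightarrow> complex \<Rightarrow> complex \<Rightarrow> complex \<Rightarrow> complex" where
  "calG_hat n \<tau> \<rho> \<eta> =
     fps_nth (fps_expansion
       (\<lambda>\<zeta>. (1 + \<eta> * \<zeta>) powr \<tau> * (1 + \<zeta> / \<eta>) powr (- \<tau>) * (1 - \<zeta>\<^sup>2) powr (- \<rho>)) 0) n"

end

theory Submission
  imports Defs
begin

unbundle no vec_syntax

text \<open>
  Write \<open>N = 2k + 1\<close> and \<open>a = N + \<lambda> - 1/2\<close>, so that both \<open>\<tau>\<close> and \<open>\<rho>\<close> equal \<open>- a\<close>.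
  The reason for the vanishing is that, up to one common factor, each sum is the coefficient of
  \<open>v^N\<close> in a product of two power series, and this product is even in \<open>v\<close> while \<open>N\<close> is odd.

  To see the product one needs the Gegenbauer polynomials as Maclaurin coefficients. The Rodrigues
  formula presents \<open>C_(N-n)^(\<lambda>+n) (X)\<close> as a multiple of the derivative of order \<open>N - n\<close> of
  \<open>(1 - X^2)^a\<close>, where the exponent \<open>a\<close> is the same for all \<open>n\<close>. By Taylor's formula that
  derivative is, again up to elementary factors, the coefficient of \<open>v^(N-n)\<close> in
  \<open>((1 - X u v)^2 - u^2 v^2)^a\<close>, whatever the scaling \<open>u\<close>.
  The factors \<open>(\<lambda>)_n\<close> and \<open>(2\<lambda> + N)_n\<close> in the sums are exactly those that make the constant
  independent of \<open>n\<close>; this is lemma \<open>gegenbauer_eq_fps_one_powr_nth\<close>. It is obtained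
  by comparing the two explicit expansions term by term, which avoids derivatives and holds
  for all complex \<open>\<lambda>\<close>.

  The choice of \<open>u\<close> is dictated by the powers of \<open>x\<close> and \<open>sqrt (1 - x^2)\<close> in the sums, and
  it makes the quadratic split as \<open>(1 - w v) (1 - v/w)\<close> for the first sum and as
  \<open>(1 + \<eta> v) (1 - v/\<eta>)\<close> for the second. One factor cancels against the factor with exponent
  \<open>\<tau>\<close> of the generating function, the other pairs with \<open>(1 + v/w)^a\<close> to give
  \<open>(1 - v^2/w^2)^a\<close>. What remains is even (lemma \<open>sum_gegenbauer_eq_0\<close>).
\<close>

section \<open>Complex powers of formal power series\<close>

text \<open>
  The power \<open>P^a\<close> of a series with constant term \<open>1\<close>, in the branch with constant term \<open>1\<close>.
\<close>

definition fps_one_powr :: "'a::field_char_0 \<Rightarrow> 'a fps \<Rightarrow> 'a fps" where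
  "fps_one_powr a P = fps_binomial a oo (P - 1)"

lemma fps_one_powr_nth_0 [simp]: "fps_one_powr a P $ 0 = 1"
  by (simp add: fps_one_powr_def)

lemma fps_one_powr_add:
  assumes "P $ 0 = 1"
  shows "fps_one_powr (a + b) P = fps_one_powr a P * fps_one_powr b P"
  using assms by (simp add: fps_one_powr_def fps_binomial_add_mult fps_compose_mult_distrib)

lemma fps_one_powr_0 [simp]: "fps_one_powr 0 P = 1"
  by (simp add: fps_one_powr_def)

lemma fps_one_powr_of_nat:
  assumes "P $ 0 = 1"
  shows "fps_one_powr (of_nat n) P = P ^ n"
  using assms by (simp add: fps_one_powr_def fps_binomial_of_nat fps_compose_add_distrib flip: fps_compose_power)

lemma fps_one_powr_minus:
  assumes "P $ 0 = 1"
  shows "fps_one_powr (-a) P * fps_one_powr a P = 1"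
  using fps_one_powr_add[OF assms, of "-a" a] by simp

text \<open>
  The logarithmic derivative of \<open>P^a\<close> is \<open>a P'/P\<close>. Since a linear equation of the first order
  has only one solution with constant term \<open>1\<close>, this yields multiplicativity in the base, which
  is hard to see from the composition with the binomial series.
\<close>

lemma fps_one_powr_ODE:
  assumes "P $ 0 = 1"
  shows "P * fps_deriv (fps_one_powr a P) = fps_const a * fps_deriv P * fps_one_powr a P"
proof -
  have "(1 + fps_X) * fps_deriv (fps_binomial a) = fps_const a * fps_binomial a"
    unfolding fps_binomial_deriv by (simp add: fps_divide_unit mult.commute mult.left_commute inverse_mult_eq_1')
  hence "((1 + fps_X) * fps_deriv (fps_binomial a)) oo (P - 1) = (fps_const a * fps_binomial a) oo (P - 1)"
    by simp
  hence "P * (fps_deriv (fps_binomial a) oo (P - 1)) = fps_const a * fps_one_powr a P"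
    using assms by (simp add: fps_compose_mult_distrib fps_compose_add_distrib fps_one_powr_def)
  moreover have "fps_deriv (fps_one_powr a P) = (fps_deriv (fps_binomial a) oo (P - 1)) * fps_deriv P"
    unfolding fps_one_powr_def using assms by (subst fps_compose_deriv) auto
  ultimately show ?thesis by (simp add: mult_ac)
qed

lemma fps_linear_ODE_unique:
  fixes F G P Q :: "'a::field_char_0 fps"
  assumes "P * fps_deriv F = Q * F" "P * fps_deriv G = Q * G"
    and "P \<noteq> 0" "F $ 0 = 1" "G $ 0 = 1"
  shows "F = G"
proof -
  have "P * (fps_deriv F * G - F * fps_deriv G) = 0"
    using assms(1,2) by (simp add: algebra_simps)
  hence *: "fps_deriv F * G = F * fps_deriv G" using assms(3) by simp
  \<comment> \<open>The Wronskian vanishes, so the quotient of the two solutions is constant.\<close>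
  have "fps_deriv (F * inverse G) =
      fps_deriv F * inverse G * (G * inverse G) - F * fps_deriv G * (inverse G)\<^sup>2"
    using assms(5) by (simp add: fps_inverse_deriv inverse_mult_eq_1')
  also have "\<dots> = (fps_deriv F * G - F * fps_deriv G) * (inverse G)\<^sup>2"
    by (simp add: algebra_simps power2_eq_square)
  finally have "fps_deriv (F * inverse G) = 0" using * by simp
  hence "F * inverse G = fps_const ((F * inverse G) $ 0)"
    by (simp only: fps_deriv_eq_0_iff)
  hence "F * inverse G = 1" using assms(4,5) by simp
  hence "F * inverse G * G = G" by simp
  thus ?thesis using assms(5) by (simp add: mult.assoc inverse_mult_eq_1)
qed

lemma fps_one_powr_mult:
  assumes "P $ 0 = 1" "Q $ 0 = 1"
  shows "fps_one_powr a (P * Q) = fps_one_powr a P * fps_one_powr a Q"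
proof (rule fps_linear_ODE_unique)
  have nz: "(P * Q) $ 0 = 1" using assms by simp
  show "P * Q * fps_deriv (fps_one_powr a (P * Q)) =
      fps_const a * fps_deriv (P * Q) * fps_one_powr a (P * Q)"
    by (rule fps_one_powr_ODE) (fact nz)
  show "P * Q \<noteq> 0" using nz by auto
  have "P * Q * fps_deriv (fps_one_powr a P * fps_one_powr a Q)
    = (P * fps_deriv (fps_one_powr a P)) * Q * fps_one_powr a Q
      + (Q * fps_deriv (fps_one_powr a Q)) * P * fps_one_powr a P"
    by (simp add: algebra_simps)
  also have "\<dots> = fps_const a * fps_deriv (P * Q) * (fps_one_powr a P * fps_one_powr a Q)"
    unfolding fps_one_powr_ODE[OF assms(1)] fps_one_powr_ODE[OF assms(2)]
    by (simp add: algebra_simps)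
  finally show "P * Q * fps_deriv (fps_one_powr a P * fps_one_powr a Q) =
      fps_const a * fps_deriv (P * Q) * (fps_one_powr a P * fps_one_powr a Q)" .
qed (use assms in simp_all)

lemma fps_one_powr_linear_nth:
  "fps_one_powr a (1 - fps_const c * fps_X) $ n = (a gchoose n) * (- c) ^ n"
proof -
  have "(1 - fps_const c * fps_X) - 1 = fps_const (- c) * fps_X"
    by (simp flip: fps_const_neg)
  thus ?thesis
    unfolding fps_one_powr_def
    by (simp only: fps_nth_compose_linear fps_binomial_nth) (rule mult.commute)
qed

lemma fps_one_powr_even:
  assumes "P $ 0 = 1" "P oo (- fps_X) = P"
  shows "fps_one_powr a P oo (- fps_X) = fps_one_powr a P"
  using assms by (simp add: fps_one_powr_def fps_compose_assoc[symmetric] fps_compose_sub_distrib)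

lemma fps_even_nth_odd:
  fixes F :: "'a::field_char_0 fps"
  assumes "F oo (- fps_X) = F" "odd n"
  shows "F $ n = 0"
  using arg_cong[OF assms(1), of "\<lambda>G. G $ n"] assms(2) by (simp add: fps_compose_uminus')

lemma fps_mult_compose_nth:
  fixes F B R :: "'a::field_char_0 fps"
  assumes "R $ 0 = 0"
  shows "(F * (B oo R)) $ m = (\<Sum>j=0..m. B $ j * (F * R ^ j) $ m)"
proof -
  have "(B oo R) $ i = (\<Sum>j=0..m. B $ j * R ^ j $ i)" if "i \<le> m" for i
    unfolding fps_compose_nth
    using that startsby_zero_power_prefix[OF assms] by (intro sum.mono_neutral_left) auto
  hence "(F * (B oo R)) $ m = (\<Sum>i=0..m. F $ i * (\<Sum>j=0..m. B $ j * R ^ j $ (m - i)))"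
    by (simp add: fps_mult_nth)
  also have "\<dots> = (\<Sum>j=0..m. B $ j * (\<Sum>i=0..m. F $ i * R ^ j $ (m - i)))"
    unfolding sum_distrib_left by (subst sum.swap) (simp add: mult_ac)
  finally show ?thesis by (simp add: fps_mult_nth)
qed

text \<open>
  Factoring out \<open>(1 - c X)^2\<close> turns the base into \<open>1 - e X^2 / (1 - c X)^2\<close>, and the binomial
  series in the second summand leaves powers of \<open>1 - c X\<close> only. Expanding in this way, rather than
  through the two linear factors, gives a sum over \<open>j\<close> of the same shape as the definition
  of the Gegenbauer polynomials.
\<close>

lemma fps_one_powr_quadratic_nth:
  fixes a c e :: "'a::field_char_0"
  shows "fps_one_powr a ((1 - fps_const c * fps_X)\<^sup>2 - fps_const e * fps_X\<^sup>2) $ m =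
    (\<Sum>j=0..m div 2. (a gchoose j) * (- e) ^ j
        * ((2 * a - 2 * of_nat j) gchoose (m - 2 * j)) * (- c) ^ (m - 2 * j))"
proof -
  define P :: "'a fps" where "P = 1 - fps_const c * fps_X"
  define R where "R = fps_const (- e) * fps_X\<^sup>2 * inverse (P\<^sup>2)"
  have P0: "P $ 0 = 1" by (simp add: P_def)
  have P20: "(P\<^sup>2) $ 0 = 1" using P0 by (simp add: power2_eq_square)
  have R0: "R $ 0 = 0" by (simp add: R_def power2_eq_square)
  have inv: "P\<^sup>2 * inverse (P\<^sup>2) = 1" using P20 by (intro inverse_mult_eq_1') simp
  have "P\<^sup>2 - fps_const e * fps_X\<^sup>2 = P\<^sup>2 * (1 + R)"
    using inv by (simp add: R_def algebra_simps flip: fps_const_neg)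
  hence "fps_one_powr a (P\<^sup>2 - fps_const e * fps_X\<^sup>2) = fps_one_powr a (P\<^sup>2) * fps_one_powr a (1 + R)"
    using P20 R0 by (simp add: fps_one_powr_mult)
  also have "fps_one_powr a (P\<^sup>2) = fps_one_powr (2 * a) P"
    by (simp only: power2_eq_square mult_2 fps_one_powr_mult[OF P0 P0] fps_one_powr_add[OF P0])
  also have "fps_one_powr a (1 + R) = fps_binomial a oo R" by (simp add: fps_one_powr_def)
  also have "(fps_one_powr (2 * a) P * (fps_binomial a oo R)) $ m =
      (\<Sum>j=0..m. (a gchoose j) * (fps_one_powr (2 * a) P * R ^ j) $ m)"
    by (simp add: fps_mult_compose_nth[OF R0])
  also have "\<dots> = (\<Sum>j=0..m. if 2 * j \<le> m then (a gchoose j) * (- e) ^ j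
        * ((2 * a - 2 * of_nat j) gchoose (m - 2 * j)) * (- c) ^ (m - 2 * j) else 0)"
  proof (rule sum.cong[OF refl])
    fix j
    have "fps_one_powr (2 * a) P = fps_one_powr (2 * a - 2 * of_nat j) P * P ^ (2 * j)"
      using fps_one_powr_add[OF P0, of "2 * a - 2 * of_nat j" "of_nat (2 * j)"] 
      by (simp del: of_nat_mult add: fps_one_powr_of_nat[OF P0]) simp
    moreover have "R ^ j = fps_const ((- e) ^ j) * fps_X ^ (2 * j) * inverse (P ^ (2 * j))"
      by (simp add: R_def power_mult_distrib fps_inverse_power power_mult flip: fps_const_power)
    moreover have "P ^ (2 * j) * inverse (P ^ (2 * j)) = 1"
      using P0 by (intro inverse_mult_eq_1') (simp add: startsby_one_power)
    ultimately have "fps_one_powr (2 * a) P * R ^ j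
       = fps_const ((- e) ^ j) * (fps_X ^ (2 * j) * fps_one_powr (2 * a - 2 * of_nat j) P)"
      by (simp add: mult_ac)
    hence "(fps_one_powr (2 * a) P * R ^ j) $ m = (- e) ^ j *
      (if m < 2 * j then 0 else fps_one_powr (2 * a - 2 * of_nat j) P $ (m - 2 * j))"
      by (simp add: fps_X_power_mult_nth)
    thus "(a gchoose j) * (fps_one_powr (2 * a) P * R ^ j) $ m = 
      (if 2 * j \<le> m then (a gchoose j) * (- e) ^ j
        * ((2 * a - 2 * of_nat j) gchoose (m - 2 * j)) * (- c) ^ (m - 2 * j) else 0)"
      by (auto simp: P_def fps_one_powr_linear_nth)
  qed
  also have "\<dots> = (\<Sum>j=0..m div 2. (a gchoose j) * (- e) ^ j
        * ((2 * a - 2 * of_nat j) gchoose (m - 2 * j)) * (- c) ^ (m - 2 * j))"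
    by (intro sum.mono_neutral_cong_right) auto
  finally show ?thesis by (simp add: P_def)
qed

section \<open>Gegenbauer polynomials as Maclaurin coefficients\<close>

text \<open>
  The ratio \<open>(2z + N)_N / (2z + N)_(N-2j)\<close> is a product of \<open>2j\<close> consecutive factors starting at
  \<open>2(z + N - j)\<close>; the duplication formula splits it into two products of \<open>j\<close> factors, one of which
  completes \<open>(z)_(N-j)\<close> to \<open>(z)_N\<close>. The cross-multiplied form has no exceptional \<open>z\<close>.
\<close>

lemma pochhammer_shift_identity:
  fixes z :: "'a::field_char_0"
  assumes "2 * j \<le> N"
  shows "pochhammer z (N - j) * pochhammer (2 * z + of_nat N) N =
    pochhammer z N * 4 ^ j * pochhammer (z + 1 / 2 + of_nat N - of_nat j) j
      * pochhammer (2 * z + of_nat N) (N - 2 * j)"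
proof -
  define y where "y = z + of_nat (N - j)"
  have z2: "2 * z + of_nat N + of_nat (N - 2 * j) = 2 * y"
    using assms by (simp add: y_def of_nat_diff algebra_simps)
  have "pochhammer (2 * z + of_nat N) N =
      pochhammer (2 * z + of_nat N) (N - 2 * j) * pochhammer (2 * y) (2 * j)"
    using pochhammer_product[of "N - 2 * j" N "2 * z + of_nat N"] assms unfolding z2 by simp
  also have "pochhammer (2 * y) (2 * j) = 4 ^ j * pochhammer y j * pochhammer (y + 1 / 2) j"
    by (simp add: pochhammer_double power_mult)
  also have "y + 1 / 2 = z + 1 / 2 + of_nat N - of_nat j"
    using assms by (simp add: y_def of_nat_diff algebra_simps)
  finally show ?thesis
    using pochhammer_product[of "N - j" N z] assms by (simp add: y_def mult_ac)
qed

text \<open>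
  A form of the Rodrigues formula in which the exponent \<open>a\<close> and the constant depend
  on \<open>N\<close> but not on \<open>n\<close>. It is cleared of denominators because the classical constant has
  \<open>(lam + 1/2)_N\<close> in the denominator, which may vanish although \<open>(2 lam + N)_N\<close> does not.
\<close>

lemma gegenbauer_eq_fps_one_powr_nth:
  fixes lam u X :: complex
  assumes "n \<le> N"
  defines "a \<equiv> of_nat N + lam - 1 / 2"
  shows "pochhammer (2 * lam + of_nat N) N * (pochhammer lam n * gegenbauer (N - n) (lam + of_nat n) X)
      * u ^ (N - n) =
    pochhammer lam N * (- 2) ^ (N - n) * pochhammer (2 * lam + of_nat N) n
      * fps_one_powr a ((1 - fps_const (X * u) * fps_X)\<^sup>2 - fps_const (u\<^sup>2) * fps_X\<^sup>2) $ (N - n)"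
proof -
  let ?m = "N - n"
  have summand: "pochhammer (2 * lam + of_nat N) N * (pochhammer lam n *
      ((-1) ^ j * pochhammer (lam + of_nat n) (?m - j) / (fact j * fact (?m - 2 * j))
        * (2 * X) ^ (?m - 2 * j))) * u ^ ?m =
    pochhammer lam N * (- 2) ^ ?m * pochhammer (2 * lam + of_nat N) n *
      ((a gchoose j) * (- (u\<^sup>2)) ^ j * ((2 * a - 2 * of_nat j) gchoose (?m - 2 * j))
        * (- (X * u)) ^ (?m - 2 * j))" (is "?l = ?r") if j: "2 * j \<le> ?m" for j
  proof -
    have l1: "pochhammer lam n * pochhammer (lam + of_nat n) (?m - j) = pochhammer lam (N - j)"
      using pochhammer_product[of n "N - j" lam] j assms(1) by (simp add: add.commute)
    have l2: "pochhammer (2 * lam + of_nat N) n * pochhammer (2 * lam + of_nat N + of_nat n) (?m - 2 * j)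
       = pochhammer (2 * lam + of_nat N) (N - 2 * j)"
      using pochhammer_product[of n "N - 2 * j" "2 * lam + of_nat N"] j assms(1)
      by (simp add: add.commute)
    have g1: "a gchoose j = pochhammer (lam + 1 / 2 + of_nat N - of_nat j) j / fact j"
      unfolding gbinomial_pochhammer' a_def by (simp add: algebra_simps)
    have "2 * a - 2 * of_nat j - of_nat (?m - 2 * j) + 1 = 2 * lam + of_nat N + of_nat n"
      using j assms(1) by (simp add: a_def of_nat_diff algebra_simps)
    hence g2: "(2 * a - 2 * of_nat j) gchoose (?m - 2 * j) =
       pochhammer (2 * lam + of_nat N + of_nat n) (?m - 2 * j) / fact (?m - 2 * j)"
      unfolding gbinomial_pochhammer' by simp
    obtain i where i: "?m = 2 * j + i" using j le_Suc_ex by blast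
    have m2j: "?m - 2 * j = i" using i by simp
    let ?D = "fact j * fact i :: complex"
    have "?l = pochhammer lam (N - j) * pochhammer (2 * lam + of_nat N) N *
        ((-1) ^ j * 2 ^ i * X ^ i * u ^ ?m / ?D)"
      unfolding l1[symmetric] m2j by (simp add: power_mult_distrib mult_ac)
    also have "\<dots> = pochhammer lam N * 4 ^ j * pochhammer (lam + 1 / 2 + of_nat N - of_nat j) j
      * pochhammer (2 * lam + of_nat N) (N - 2 * j) * ((-1) ^ j * 2 ^ i * X ^ i * u ^ ?m / ?D)"
      by (subst pochhammer_shift_identity) (use j in auto)
    also have "\<dots> = pochhammer lam N * pochhammer (lam + 1 / 2 + of_nat N - of_nat j) j
        * pochhammer (2 * lam + of_nat N) (N - 2 * j)
        * (4 ^ j * ((-1) ^ j * 2 ^ i * X ^ i * u ^ ?m)) / ?D"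
      by (simp only: mult_ac times_divide_eq_right)
    also have "4 ^ j * ((-1) ^ j * 2 ^ i * X ^ i * u ^ ?m) =
        (-2) ^ ?m * (- (u\<^sup>2)) ^ j * (- (X * u)) ^ i"
    proof -
      have "(- (u\<^sup>2)) ^ j = (-1) ^ j * u ^ (2 * j)"
        by (subst power_minus) (simp add: power_mult)
      moreover have "(- (X * u)) ^ i = (-1) ^ i * X ^ i * u ^ i"
        by (subst power_minus) (simp add: power_mult_distrib)
      moreover have "(-2 :: complex) ^ i = (-1) ^ i * 2 ^ i"
        by (subst power_minus) simp
      moreover have "(-1 :: complex) ^ i * (-1) ^ i = 1"
        by (simp flip: power_mult_distrib)
      moreover have four_pow: "(- 2 :: complex) ^ (2 * j) = 4 ^ j"
        by (simp add: power_mult)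
      ultimately show ?thesis
        unfolding i power_add four_pow by (simp add: mult_ac)
    qed
    also have "pochhammer lam N * pochhammer (lam + 1 / 2 + of_nat N - of_nat j) j
        * pochhammer (2 * lam + of_nat N) (N - 2 * j)
        * ((-2) ^ ?m * (- (u\<^sup>2)) ^ j * (- (X * u)) ^ i) / ?D = ?r"
      unfolding l2[symmetric] g1 g2[unfolded m2j] m2j
      by (simp only: mult_ac times_divide_eq_right times_divide_eq_left divide_divide_eq_left)
    finally show ?thesis .
  qed
  show ?thesis
    unfolding fps_one_powr_quadratic_nth gegenbauer_def sum_distrib_left sum_distrib_right
    by (intro sum.cong refl summand) auto
qed

section \<open>The generating functions as formal products\<close>

lemma has_fps_expansion_powr_one:
  fixes f :: "complex \<Rightarrow> complex"
  assumes "f has_fps_expansion P" "P $ 0 = 1"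
  shows "(\<lambda>z. f z powr a) has_fps_expansion fps_one_powr a P"
proof -
  have "(\<lambda>z. f z - 1) has_fps_expansion (P - 1)"
    by (intro fps_expansion_intros assms)
  from has_fps_expansion_compose[OF has_fps_expansion_binomial_complex this, of a] assms(2)
  show ?thesis by (simp add: fps_one_powr_def o_def)
qed

lemma calG_eq_fps_nth:
  "calG n \<tau> \<rho> w =
     (fps_one_powr \<tau> (1 - fps_const w * fps_X) * fps_one_powr (- \<tau>) (1 + fps_const (1 / w) * fps_X)
       * fps_one_powr (- \<rho>) (1 + fps_X\<^sup>2)) $ n"
proof -
  have "(\<lambda>z. (1 - w * z) powr \<tau>) has_fps_expansion fps_one_powr \<tau> (1 - fps_const w * fps_X)"
    by (intro has_fps_expansion_powr_one fps_expansion_intros) simp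
  moreover have "(\<lambda>z. (1 + 1 / w * z) powr (- \<tau>)) has_fps_expansion
      fps_one_powr (- \<tau>) (1 + fps_const (1 / w) * fps_X)"
    by (intro has_fps_expansion_powr_one fps_expansion_intros) simp
  moreover have "(\<lambda>z. (1 + z\<^sup>2) powr (- \<rho>)) has_fps_expansion fps_one_powr (- \<rho>) (1 + fps_X\<^sup>2)"
    by (intro has_fps_expansion_powr_one fps_expansion_intros) (simp add: power2_eq_square)
  ultimately have "(\<lambda>z. (1 - w * z) powr \<tau> * (1 + 1 / w * z) powr (- \<tau>) * (1 + z\<^sup>2) powr (- \<rho>))
      has_fps_expansion fps_one_powr \<tau> (1 - fps_const w * fps_X)
        * fps_one_powr (- \<tau>) (1 + fps_const (1 / w) * fps_X) * fps_one_powr (- \<rho>) (1 + fps_X\<^sup>2)"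
    by (intro has_fps_expansion_mult)
  from fps_expansion_eqI[OF this] show ?thesis by (simp add: calG_def)
qed

lemma calG_hat_eq_fps_nth:
  "calG_hat n \<tau> \<rho> \<eta> =
     (fps_one_powr \<tau> (1 + fps_const \<eta> * fps_X) * fps_one_powr (- \<tau>) (1 + fps_const (1 / \<eta>) * fps_X)
       * fps_one_powr (- \<rho>) (1 - fps_X\<^sup>2)) $ n"
proof -
  have "(\<lambda>z. (1 + c * z) powr \<tau>) has_fps_expansion fps_one_powr \<tau> (1 + fps_const c * fps_X)"
    for \<tau> c :: complex
    by (intro has_fps_expansion_powr_one fps_expansion_intros) simp
  note this[of \<eta> \<tau>] this[of "1 / \<eta>" "- \<tau>"]
  moreover have "(\<lambda>z. (1 - z\<^sup>2) powr (- \<rho>)) has_fps_expansion fps_one_powr (- \<rho>) (1 - fps_X\<^sup>2)"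
    by (intro has_fps_expansion_powr_one fps_expansion_intros) (simp add: power2_eq_square)
  ultimately have "(\<lambda>z. (1 + \<eta> * z) powr \<tau> * (1 + 1 / \<eta> * z) powr (- \<tau>) * (1 - z\<^sup>2) powr (- \<rho>))
      has_fps_expansion fps_one_powr \<tau> (1 + fps_const \<eta> * fps_X)
        * fps_one_powr (- \<tau>) (1 + fps_const (1 / \<eta>) * fps_X) * fps_one_powr (- \<rho>) (1 - fps_X\<^sup>2)"
    by (intro has_fps_expansion_mult)
  from fps_expansion_eqI[OF this] show ?thesis by (simp add: calG_hat_def)
qed

section \<open>The sums as coefficients of an even series\<close>

lemma sum_gegenbauer_eq_fps_mult_nth:
  fixes lam u X :: complex and G :: "complex fps"
  assumes "pochhammer (2 * lam + of_nat N) N \<noteq> 0" "u \<noteq> 0"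
  defines "a \<equiv> of_nat N + lam - 1 / 2"
  shows "(\<Sum>n=0..N. pochhammer lam n * G $ n
      / (pochhammer (2 * lam + of_nat N) n * (- 2) powi (- int n) * u ^ n)
      * gegenbauer (N - n) (lam + of_nat n) X) =
    pochhammer lam N * (- 2) ^ N / (pochhammer (2 * lam + of_nat N) N * u ^ N)
      * (G * fps_one_powr a ((1 - fps_const (X * u) * fps_X)\<^sup>2 - fps_const (u\<^sup>2) * fps_X\<^sup>2)) $ N"
proof -
  let ?b = "2 * lam + of_nat N"
  let ?H = "fps_one_powr a ((1 - fps_const (X * u) * fps_X)\<^sup>2 - fps_const (u\<^sup>2) * fps_X\<^sup>2)"
  have "pochhammer lam n * G $ n / (pochhammer ?b n * (- 2) powi (- int n) * u ^ n)
      * gegenbauer (N - n) (lam + of_nat n) X =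
    pochhammer lam N * (- 2) ^ N / (pochhammer ?b N * u ^ N) * (G $ n * ?H $ (N - n))"
    if "n \<le> N" for n
  proof -
    have nz: "pochhammer ?b n \<noteq> 0"
      using assms(1) pochhammer_product[OF that, of ?b] by auto
    have "pochhammer ?b N * (pochhammer lam n * gegenbauer (N - n) (lam + of_nat n) X) * u ^ (N - n) =
        pochhammer lam N * (- 2) ^ (N - n) * pochhammer ?b n * ?H $ (N - n)"
      unfolding a_def by (rule gegenbauer_eq_fps_one_powr_nth[OF that])
    moreover have "u ^ N = u ^ (N - n) * u ^ n" "(- 2 :: complex) ^ N = (- 2) ^ (N - n) * (- 2) ^ n"
      using that by (simp_all flip: power_add)
    moreover have "(- 2 :: complex) powi (- int n) = 1 / (- 2) ^ n"
      by (simp add: power_int_minus inverse_eq_divide)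
    ultimately show ?thesis
      using nz assms(1,2) by (simp add: field_simps)
  qed
  thus ?thesis
    by (simp add: fps_mult_nth sum_distrib_left)
qed

text \<open>
  Both sums of the theorem are instances: the quadratic of the preceding lemma has the linear
  factors \<open>1 - (X u - u) v\<close> and \<open>1 - (X u + u) v\<close>, the first of which is cancelled by \<open>G\<close> while
  the second is completed by \<open>G\<close> to an even polynomial. The even series \<open>E\<close> stands for
  \<open>1 + v^2\<close> or \<open>1 - v^2\<close>.
\<close>

lemma sum_gegenbauer_eq_0:
  fixes lam u X :: complex and E :: "complex fps"
  assumes "odd N" "pochhammer (2 * lam + of_nat N) N \<noteq> 0" "u \<noteq> 0"
    and E: "E $ 0 = 1" "E oo (- fps_X) = E"
  defines "a \<equiv> of_nat N + lam - 1 / 2"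
  defines "G \<equiv> fps_one_powr (- a) (1 - fps_const (X * u - u) * fps_X)
      * fps_one_powr a (1 + fps_const (X * u + u) * fps_X) * fps_one_powr a E"
  shows "(\<Sum>n=0..N. pochhammer lam n * G $ n
      / (pochhammer (2 * lam + of_nat N) n * (- 2) powi (- int n) * u ^ n)
      * gegenbauer (N - n) (lam + of_nat n) X) = 0"
proof -
  define c where "c = X * u + u"
  let ?P = "1 - fps_const (X * u - u) * fps_X" and ?Q = "1 - fps_const c * fps_X"
    and ?R = "1 + fps_const c * fps_X"
  have QR: "?R * ?Q = 1 - fps_const (c\<^sup>2) * fps_X\<^sup>2"
    by (simp add: algebra_simps power2_eq_square flip: fps_const_mult)
  have "(1 - fps_const (X * u) * fps_X)\<^sup>2 - fps_const (u\<^sup>2) * fps_X\<^sup>2 = ?P * ?Q"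
    unfolding c_def
    by (simp add: algebra_simps power2_eq_square flip: fps_const_mult fps_const_add fps_const_sub)
  hence "G * fps_one_powr a ((1 - fps_const (X * u) * fps_X)\<^sup>2 - fps_const (u\<^sup>2) * fps_X\<^sup>2)
    = (fps_one_powr (- a) ?P * fps_one_powr a ?P)
        * (fps_one_powr a ?R * fps_one_powr a ?Q) * fps_one_powr a E"
    by (simp only:) (simp add: G_def fps_one_powr_mult c_def mult_ac del: fps_const_add fps_const_sub)
  also have "\<dots> = fps_one_powr a (?R * ?Q * E)"
    using E(1) by (simp add: fps_one_powr_mult fps_one_powr_minus)
  also have "\<dots> $ N = 0"
    unfolding QR using assms(1) E
    by (intro fps_even_nth_odd[OF fps_one_powr_even])
       (simp_all add: power2_eq_square fps_compose_mult_distrib fps_compose_sub_distrib)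
  finally show ?thesis
    using assms(2,3) unfolding a_def by (subst sum_gegenbauer_eq_fps_mult_nth) auto
qed

lemma powr_minus_half_nat:
  fixes y :: real
  assumes "y > 0"
  shows "y powr (- (real n / 2)) = (1 / sqrt y) ^ n"
proof -
  have "sqrt y ^ n = y powr (real n / 2)"
    using assms by (simp add: powr_half_sqrt[symmetric] powr_powr flip: powr_realpow)
  thus ?thesis by (simp add: powr_minus power_divide inverse_eq_divide)
qed

theorem corollary15:
  fixes x :: real and k :: nat and lam :: complex
  assumes "0 < x" and "x < 1"
    and "pochhammer (2 * lam + 2 * of_nat k + 1) (2 * k + 1) \<noteq> 0"
  shows "(\<Sum>n=0..2*k+1.
            pochhammer lam n
              * calG n (- 2 * of_nat k - lam - 1/2) (- 2 * of_nat k - lam - 1/2)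
                  (of_real (sqrt ((1 - x) / (1 + x))))
            / (pochhammer (2 * lam + 2 * of_nat k + 1) n
                 * (-2) powi (- int n) * of_real ((1 - x\<^sup>2) powr (- (real n / 2))) * of_real x ^ n)
            * gegenbauer (2 * k + 1 - n) (lam + of_nat n) (of_real (1 / x))) = 0
    \<and> (\<Sum>n=0..2*k+1.
            pochhammer lam n
              * calG_hat n (- 2 * of_nat k - lam - 1/2) (- 2 * of_nat k - lam - 1/2)
                  (of_real (sqrt ((1 - x) / (1 + x))))
            / (pochhammer (2 * lam + 2 * of_nat k + 1) n
                 * (-2) powi (- int n) * of_real ((1 - x\<^sup>2) powr (- (real n / 2))))
            * gegenbauer (2 * k + 1 - n) (lam + of_nat n) (of_real x)) = 0"
proof -
  define s where "s = sqrt (1 - x\<^sup>2)"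
  define w where "w = sqrt ((1 - x) / (1 + x))"
  have s2: "1 - x\<^sup>2 = (1 - x) * (1 + x)" by (simp add: power2_eq_square algebra_simps)
  have pos: "1 - x\<^sup>2 > 0" using assms(1,2) unfolding s2 by simp
  hence s_pos: "s > 0" by (simp add: s_def)
  have w: "w = (1 - x) / s" and w_inv: "1 / w = (1 + x) / s"
    using assms(1,2) real_sqrt_mult_self[of "1 - x"] real_sqrt_mult_self[of "1 + x"]
    unfolding w_def s_def s2 real_sqrt_mult real_sqrt_divide by (auto simp: divide_simps)
  have powr: "(1 - x\<^sup>2) powr (- (real n / 2)) = (1 / s) ^ n" for n
    unfolding s_def by (rule powr_minus_half_nat[OF pos])
  let ?N = "2 * k + 1"
  have N: "2 * lam + of_nat ?N = 2 * lam + 2 * of_nat k + 1"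
    "- (of_nat ?N + lam - 1 / 2) = - 2 * of_nat k - lam - 1 / 2"
    "of_nat ?N + lam - 1 / 2 = - (- 2 * of_nat k - lam - 1 / 2)"
    by (simp_all add: algebra_simps)
  have odd: "odd ?N" by simp
  have even: "(1 + fps_X\<^sup>2) oo (- fps_X) = (1 + fps_X\<^sup>2 :: complex fps)"
    "(1 - fps_X\<^sup>2) oo (- fps_X) = (1 - fps_X\<^sup>2 :: complex fps)"
    by (simp_all add: power2_eq_square fps_compose_mult_distrib fps_compose_sub_distrib
        fps_compose_add_distrib)
  have E0: "(1 + fps_X\<^sup>2 :: complex fps) $ 0 = 1" "(1 - fps_X\<^sup>2 :: complex fps) $ 0 = 1"
    by (simp_all add: power2_eq_square)
  define W where "W = complex_of_real w"
  have real_lin: "1 / x * (x / s) - x / s = w" "1 / x * (x / s) + x / s = 1 / w"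
    "x * (1 / s) - 1 / s = - w" "x * (1 / s) + 1 / s = 1 / w"
    using assms(1) unfolding w_inv unfolding w
    by (simp_all add: diff_divide_distrib add_divide_distrib)
  \<comment> \<open>The scalings are \<open>u = x/s\<close> with \<open>X = 1/x\<close>, and \<open>u = 1/s\<close> with \<open>X = x\<close>; they turn the
      linear coefficients \<open>X u - u\<close> and \<open>X u + u\<close> into \<open>w\<close> (or \<open>- w\<close>) and \<open>1/w\<close>.\<close>
  note lin = real_lin[THEN arg_cong[where f = complex_of_real],
      unfolded of_real_mult of_real_diff of_real_add of_real_minus]
  have w_inv': "complex_of_real (1 / w) = 1 / W" by (simp add: W_def)
  have neg: "1 - fps_const (- W) * fps_X = 1 + fps_const W * fps_X"
    by (simp flip: fps_const_neg)
  have "(\<Sum>n=0..?N. pochhammer lam n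
              * calG n (- 2 * of_nat k - lam - 1/2) (- 2 * of_nat k - lam - 1/2) W
            / (pochhammer (2 * lam + 2 * of_nat k + 1) n
                 * (-2) powi (- int n) * of_real (x / s) ^ n)
            * gegenbauer (?N - n) (lam + of_nat n) (of_real (1 / x))) = 0"
    using sum_gegenbauer_eq_0[OF odd _ _ E0(1) even(1), of lam "of_real (x / s)" "of_real (1 / x)"]
      assms s_pos
    unfolding lin w_inv' W_def[symmetric] N(1) N(2) unfolding N(3) calG_eq_fps_nth by simp
  moreover have "(\<Sum>n=0..?N. pochhammer lam n
              * calG_hat n (- 2 * of_nat k - lam - 1/2) (- 2 * of_nat k - lam - 1/2) W
            / (pochhammer (2 * lam + 2 * of_nat k + 1) n
                 * (-2) powi (- int n) * of_real (1 / s) ^ n)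
            * gegenbauer (?N - n) (lam + of_nat n) (of_real x)) = 0"
    using sum_gegenbauer_eq_0[OF odd _ _ E0(2) even(2), of lam "of_real (1 / s)" "of_real x"]
      assms s_pos
    unfolding lin w_inv' W_def[symmetric] N(1) N(2) unfolding N(3) neg calG_hat_eq_fps_nth by simp
  moreover have "c * of_real ((1 / s) ^ n) * of_real x ^ n = c * of_real (x / s) ^ n"
    for c :: complex and n
    by (simp add: power_divide)
  ultimately show ?thesis
    unfolding powr w_def[symmetric] W_def[symmetric] by (simp only: of_real_power)
qed

end
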